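(* Let $d\ge 1$ be an integer, let $L$ be a positive integer, and let $A$ be a nonempty finite subset of $\mathbf{Z}^d$. Let $m$ be an integer such that \[ m > 2L\max(\|a\| : a \in A). \] Define $\psi: \mathbf{Z}^d \rightarrow \mathbf{Z}$ by \[ \psi(a_1,\ldots,a_d) = \sum_{i=1}^d a_i m^{i-1}. \] If $h$ and $k$ are nonnegative integers such that $h+k \leq L$, then \[ |hA-kA| = |h\psi(A) - k\psi(A)|. \]
   Context: For $a=(a_1,\ldots,a_d)\in\mathbf{Z}^d$, $\|a\| = \max(|a_i| : i=1,\ldots,d)$. For a nonempty subset $A$ of an abelian group and nonnegative integers $h,k$, $hA$ denotes the $h$-fold sumset ($0A=\{0\}$, $1A=A$, $hA=(h-1)A+A$ for $h \geq 2$), and $hA-kA = \{a_1+\cdots+a_h-a'_1-\cdots-a'_k : a_j, a'_\ell\in A\}$ is the generalized sum-difference set. $|X|$ denotes cardinality, and $\psi(A)$ is the image of $A$. *)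

theory Defs
  imports Main "HOL-Library.Function_Algebras"
begin

text \<open>
  The group \<open>\<int>\<^sup>d\<close> is the subgroup of \<open>nat \<Rightarrow> int\<close> (pointwise operations) of those functions
  that vanish off the index set \<open>{1..d}\<close>; the value at \<open>i\<close> is the \<open>i\<close>-th coordinate.
  This makes \<open>d\<close> an ordinary natural number and gives the coordinates their order.
\<close>
definition int_space :: "nat \<Rightarrow> (nat \<Rightarrow> int) set" where
  "int_space d = {a. \<forall>i. i \<notin> {1..d} \<longrightarrow> a i = 0}"

text \<open>Meaningful for \<open>d \<ge> 1\<close> only, since the maximum of the empty set is unspecified.\<close>
definition max_norm :: "nat \<Rightarrow> (nat \<Rightarrow> int) \<Rightarrow> int" where
  "max_norm d a = Max ((\<lambda>i. \<bar>a i\<bar>) ` {1..d})"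

text \<open>
  The set \<open>hA - kA\<close>. Summands may repeat, and empty sums are \<open>0\<close>, so \<open>0A - 0A = {0}\<close>.
\<close>
definition sum_diff_set :: "nat \<Rightarrow> nat \<Rightarrow> 'a::ab_group_add set \<Rightarrow> 'a set" where
  "sum_diff_set h k A =
     {(\<Sum>j=1..h. a j) - (\<Sum>l=1..k. a' l) | a a'. (\<forall>j\<in>{1..h}. a j \<in> A) \<and> (\<forall>l\<in>{1..k}. a' l \<in> A)}"

definition psi :: "nat \<Rightarrow> int \<Rightarrow> (nat \<Rightarrow> int) \<Rightarrow> int" where
  "psi d m a = (\<Sum>i=1..d. a i * m ^ (i - 1))"

end

theory Submission
  imports Defs "HOL.Modules"
begin

text \<open>
  The map \<open>\<psi>\<close> is additive, so it maps \<open>hA - kA\<close> onto \<open>h\<psi>(A) - k\<psi>(A)\<close>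
  (\<open>sum_diff_set_image\<close>), and it remains to show that \<open>\<psi>\<close> is injective on \<open>hA - kA\<close>.
  If \<open>M\<close> is the largest norm of an element of \<open>A\<close>, then the elements of \<open>hA - kA\<close> have
  coordinates of absolute value at most \<open>(h + k) M \<le> L M\<close> (\<open>sum_diff_set_coord_bound\<close>).
  Hence the coordinates of the difference of two of them are at most \<open>2 L M < m\<close> in absolute
  value. If \<open>\<psi>\<close> agrees on the two elements, the difference is a representation of \<open>0\<close> in base \<open>m\<close>
  with signed digits smaller than \<open>m\<close> in absolute value, and every digit of such a representation
  vanishes (\<open>psi_eq_0_imp_coords_eq_0\<close>).
\<close>

text \<open>Splitting off the lowest digit, as in Horner's scheme.\<close>
lemma psi_Suc: "psi (Suc d) m a = a 1 + m * psi d m (\<lambda>i. a (Suc i))"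
proof -
  have "psi (Suc d) m a = a 1 + (\<Sum>i=1..d. a (Suc i) * m ^ i)"
    unfolding psi_def by (simp add: sum.atLeast_Suc_atMost sum.shift_bounds_cl_Suc_ivl
        del: sum.cl_ivl_Suc)
  also have "(\<Sum>i=1..d. a (Suc i) * m ^ i) = (\<Sum>i=1..d. m * (a (Suc i) * m ^ (i - 1)))"
    by (intro sum.cong refl) (auto simp: power_eq_if)
  finally show ?thesis
    by (simp add: psi_def sum_distrib_left)
qed

text \<open>
  The digits are found one at a time, lowest first: the lowest one is divisible by \<open>m\<close>.
\<close>
lemma psi_eq_0_imp_coords_eq_0:
  assumes "psi d m c = 0" and "\<And>i. i \<in> {1..d} \<Longrightarrow> \<bar>c i\<bar> < m" and "i \<in> {1..d}"
  shows "c i = 0"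
  using assms
proof (induction d arbitrary: c i)
  case 0
  then show ?case by simp
next
  case (Suc d)
  have eq: "c 1 + m * psi d m (\<lambda>i. c (Suc i)) = 0"
    using Suc.prems(1) by (simp add: psi_Suc)
  have lt: "\<bar>c 1\<bar> < m"
    using Suc.prems(2) by simp
  have "m dvd c 1"
    using eq by (metis dvd_add_times_triv_right_iff dvd_0_right mult.commute)
  then have c1: "c 1 = 0"
    using lt dvd_imp_le_int[of "c 1" m] by linarith
  then have "psi d m (\<lambda>i. c (Suc i)) = 0"
    using eq lt by simp
  then have tail: "c (Suc j) = 0" if "j \<in> {1..d}" for j
    using Suc.IH[of "\<lambda>i. c (Suc i)" j] Suc.prems(2) that by simp
  show ?case
  proof (cases "i = 1")
    case True
    then show ?thesis using c1 by simp
  next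
    case False
    then obtain j where "i = Suc j" and "j \<in> {1..d}"
      using Suc.prems(3) by (cases i) auto
    then show ?thesis using tail by simp
  qed
qed

lemma additive_psi: "additive (psi d m)"
  by unfold_locales (simp add: psi_def algebra_simps sum.distrib)

lemma additive_coord: "additive (\<lambda>x :: nat \<Rightarrow> int. x i)"
  by unfold_locales simp

lemma additive_sum_diff:
  assumes "additive f"
  shows "f ((\<Sum>j=1..h. a j) - (\<Sum>l=1..k. a' l)) = (\<Sum>j=1..h. f (a j)) - (\<Sum>l=1..k. f (a' l))"
  using assms by (simp add: additive.diff additive.sum)

lemma sum_diff_set_image:
  fixes f :: "'a::ab_group_add \<Rightarrow> 'b::ab_group_add"
  assumes "additive f"
  shows "f ` sum_diff_set h k A = sum_diff_set h k (f ` A)"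
proof
  show "f ` sum_diff_set h k A \<subseteq> sum_diff_set h k (f ` A)"
  proof
    fix y assume "y \<in> f ` sum_diff_set h k A"
    then obtain a a' where "y = f ((\<Sum>j=1..h. a j) - (\<Sum>l=1..k. a' l))"
      and a: "\<forall>j\<in>{1..h}. a j \<in> A" and a': "\<forall>l\<in>{1..k}. a' l \<in> A"
      unfolding sum_diff_set_def by blast
    then have y: "y = (\<Sum>j=1..h. f (a j)) - (\<Sum>l=1..k. f (a' l))"
      by (simp only: additive_sum_diff[OF assms])
    show "y \<in> sum_diff_set h k (f ` A)"
      unfolding sum_diff_set_def mem_Collect_eq using a a'
      by (intro exI[of _ "\<lambda>j. f (a j)"] exI[of _ "\<lambda>l. f (a' l)"] conjI y) blast+
  qed
next
  show "sum_diff_set h k (f ` A) \<subseteq> f ` sum_diff_set h k A"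
  proof
    fix y assume "y \<in> sum_diff_set h k (f ` A)"
    then obtain b b' where y: "y = (\<Sum>j=1..h. b j) - (\<Sum>l=1..k. b' l)"
      and b: "\<forall>j\<in>{1..h}. b j \<in> f ` A" and b': "\<forall>l\<in>{1..k}. b' l \<in> f ` A"
      unfolding sum_diff_set_def by blast
    obtain a where a: "\<forall>j\<in>{1..h}. a j \<in> A \<and> b j = f (a j)"
      using bchoice[of "{1..h}" "\<lambda>j x. x \<in> A \<and> b j = f x"] b by blast
    obtain a' where a': "\<forall>l\<in>{1..k}. a' l \<in> A \<and> b' l = f (a' l)"
      using bchoice[of "{1..k}" "\<lambda>l x. x \<in> A \<and> b' l = f x"] b' by blast
    have "y = f ((\<Sum>j=1..h. a j) - (\<Sum>l=1..k. a' l))"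
      unfolding additive_sum_diff[OF assms] y using a a' by simp
    then show "y \<in> f ` sum_diff_set h k A"
      unfolding sum_diff_set_def using a a' by blast
  qed
qed

lemma sum_diff_set_coord_bound:
  fixes A :: "(nat \<Rightarrow> int) set"
  assumes "x \<in> sum_diff_set h k A" and bound: "\<And>a. a \<in> A \<Longrightarrow> \<bar>a i\<bar> \<le> M"
  shows "\<bar>x i\<bar> \<le> int (h + k) * M"
proof -
  obtain a a' where x: "x = (\<Sum>j=1..h. a j) - (\<Sum>l=1..k. a' l)"
    and a: "\<forall>j\<in>{1..h}. a j \<in> A" and a': "\<forall>l\<in>{1..k}. a' l \<in> A"
    using assms(1) unfolding sum_diff_set_def by blast
  have xi: "x i = (\<Sum>j=1..h. a j i) - (\<Sum>l=1..k. a' l i)"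
    unfolding x by (rule additive_sum_diff[OF additive_coord])
  have "\<bar>x i\<bar> \<le> \<bar>\<Sum>j=1..h. a j i\<bar> + \<bar>\<Sum>l=1..k. a' l i\<bar>"
    unfolding xi by (rule abs_triangle_ineq4)
  also have "\<dots> \<le> (\<Sum>j=1..h. \<bar>a j i\<bar>) + (\<Sum>l=1..k. \<bar>a' l i\<bar>)"
    by (intro add_mono sum_abs)
  also have "\<dots> \<le> (\<Sum>j=1..h. M) + (\<Sum>l=1..k. M)"
    using a a' bound by (intro add_mono sum_mono) auto
  finally show ?thesis by (simp add: algebra_simps)
qed

lemma abs_coord_le_max_norm: "i \<in> {1..d} \<Longrightarrow> \<bar>a i\<bar> \<le> max_norm d a"
  unfolding max_norm_def by (intro Max_ge) auto

theorem theorem9: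
  fixes d L h k :: nat and m :: int and A :: "(nat \<Rightarrow> int) set"
  assumes "d \<ge> 1" and "L \<ge> 1"
    and "A \<subseteq> int_space d" and "finite A" and "A \<noteq> {}"
    and "m > 2 * int L * Max (max_norm d ` A)"
    and "h + k \<le> L"
  shows "card (sum_diff_set h k A) = card (sum_diff_set h k (psi d m ` A))"
proof -
  define M where "M = Max (max_norm d ` A)"
  have coord: "\<bar>a i\<bar> \<le> M" if "a \<in> A" "i \<in> {1..d}" for a i
  proof -
    have "max_norm d a \<le> M"
      unfolding M_def using \<open>finite A\<close> that(1) by (intro Max_ge) auto
    with abs_coord_le_max_norm[OF that(2), of a] show ?thesis by linarith
  qed
  have "M \<ge> 0"
    using coord[of _ 1] \<open>A \<noteq> {}\<close> \<open>d \<ge> 1\<close> by fastforce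
  then have "int (h + k) * M \<le> int L * M"
    using \<open>h + k \<le> L\<close> by (intro mult_right_mono) auto
  then have bound: "\<bar>x i\<bar> \<le> int L * M" if "x \<in> sum_diff_set h k A" "i \<in> {1..d}" for x i
    using sum_diff_set_coord_bound[OF that(1), of i M] coord that(2) by fastforce
  \<comment> \<open>Off \<open>{1..d}\<close> the coordinate bound holds with \<open>M = 0\<close>.\<close>
  have off: "x i = 0" if "x \<in> sum_diff_set h k A" "i \<notin> {1..d}" for x i
    using sum_diff_set_coord_bound[OF that(1), of i 0] \<open>A \<subseteq> int_space d\<close> that(2)
    unfolding int_space_def by auto
  have "inj_on (psi d m) (sum_diff_set h k A)"
  proof (intro inj_onI ext)
    fix x y i
    assume x: "x \<in> sum_diff_set h k A" and y: "y \<in> sum_diff_set h k A"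
      and eq: "psi d m x = psi d m y"
    show "x i = y i"
    proof (cases "i \<in> {1..d}")
      case True
      have "psi d m (x - y) = 0"
        using eq by (simp add: additive.diff[OF additive_psi])
      moreover have "\<bar>(x - y) j\<bar> < m" if "j \<in> {1..d}" for j
        using bound[OF x that] bound[OF y that] assms(6) by (simp add: M_def)
      ultimately have "(x - y) i = 0"
        using True by (rule psi_eq_0_imp_coords_eq_0)
      then show ?thesis by simp
    next
      case False
      then show ?thesis using off[OF x] off[OF y] by metis
    qed
  qed
  then have "card (psi d m ` sum_diff_set h k A) = card (sum_diff_set h k A)"
    by (rule card_image)
  then show ?thesis
    by (simp add: sum_diff_set_image[OF additive_psi])
qed

end
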